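(* Let $n\ge 1$ be an integer. Let $(A,B,W)$ be a partition of $\{0,1\}^n$ and assume $|A|=\frac12$. Then $$|\nabla(A,B)| + \sqrt{n}\,|W|\ge \tfrac12.$$
   Context: The Hamming cube is the graph with vertex set $\{0,1\}^n$ in which two points are joined by an edge if and only if they differ in exactly one coordinate; $\mathcal{E}$ denotes its set of edges. A partition $(A,B,W)$ of $\{0,1\}^n$ means that $A,B,W$ are pairwise disjoint subsets with union $\{0,1\}^n$ (parts are allowed to be empty). For $S\subset\{0,1\}^n$, $|S|=\mathbf{E}\mathbf{1}_S=2^{-n}\sum_{x\in\{0,1\}^n}\mathbf{1}_S(x)$ is the normalized counting measure of $S$ (not its cardinality). The edge boundary measure is $|\nabla(A,B)| = 2^{-n}\,\#\{(x,y)\in\mathcal{E} : x\in A,\ y\in B\}$, i.e. $2^{-n}$ times the number of edges with one endpoint in $A$ and the other in $B$ (each such edge counted once). *)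

theory Defs
  imports "HOL-Analysis.Analysis"
begin

(* A point of {0,1}^n is a bool list of length n, with False for 0 and True for 1. *)
definition cube :: "nat \<Rightarrow> bool list set" where
  "cube n = {x. length x = n}"

(* The edge set as a symmetric relation: an edge joining x and y is represented
   by both ordered pairs (x,y) and (y,x). *)
definition hamming_edges :: "nat \<Rightarrow> (bool list \<times> bool list) set" where
  "hamming_edges n =
     {(x, y). x \<in> cube n \<and> y \<in> cube n \<and> card {i. i < n \<and> x ! i \<noteq> y ! i} = 1}"

definition cube_measure :: "nat \<Rightarrow> bool list set \<Rightarrow> real" where
  "cube_measure n S = (\<Sum>x\<in>cube n. indicator S x) / 2 ^ n"

(* For disjoint A and B exactly one orientation of an edge between A and B has its
   first point in A and its second in B, so each such edge is counted once. *)
definition edge_boundary_measure ::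
  "nat \<Rightarrow> bool list set \<Rightarrow> bool list set \<Rightarrow> real" where
  "edge_boundary_measure n A B =
     real (card {(x, y) \<in> hamming_edges n. x \<in> A \<and> y \<in> B}) / 2 ^ n"

definition is_cube_partition ::
  "nat \<Rightarrow> bool list set \<Rightarrow> bool list set \<Rightarrow> bool list set \<Rightarrow> bool" where
  "is_cube_partition n A B W \<longleftrightarrow>
     A \<union> B \<union> W = cube n \<and> A \<inter> B = {} \<and> A \<inter> W = {} \<and> B \<inter> W = {}"

end

theory Submission
  imports Defs
begin

text \<open>
The proof compares \<open>f = 1\<close> on the side of \<open>A\<close> and \<open>f = - 1\<close> on the side of \<open>B\<close> with its
noisy averages. Write \<open>Tq f x\<close> for the mean of \<open>f\<close> at the point obtained from \<open>x\<close> by flipping every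
coordinate independently with probability \<open>q\<close>. As \<open>q\<close> grows from 0 to \<open>1/2\<close>, the correlation
\<open>E f (Tq f)\<close> falls from 1 to \<open>(E f)\<^sup>2\<close>, and its derivative is a sum over the edges on which \<open>f\<close>
changes sign. The two endpoints of such an edge contribute equally, so each edge can be charged to whichever
endpoint is convenient (\<open>sum_edge_flow_charged\<close>).

What a vertex pays for \<open>h\<close> charged edges is at most the integral over \<open>[0, 1/2]\<close> of
\<open>\<Sum>m. \<bar>b_m'(q)\<bar>\<close>, where \<open>b_m(q)\<close> is the probability that \<open>m\<close> of the \<open>h\<close> coordinates are flipped. This
is a total variation of unimodal functions, hence a sum of their peak values, and Abel's identity
evaluates it to the Ramanujan function
\<open>Q(h) = 1 + (1 - 1/h) + (1 - 1/h) (1 - 2/h) + \<dots>\<close> (\<open>has_integral_Bernstein_variation\<close>). Since the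
weighted sum of these terms with weights \<open>1, 2, 3, \<dots>\<close> telescopes to \<open>h\<close>, one has \<open>Q(h)\<^sup>2 + Q(h) \<le> 2 h\<close>
(\<open>Ramanujan_Q_bounds\<close>). Altogether \<open>(1 - (E f)\<^sup>2) / 2\<close> is at most the normalised sum of the
\<open>Q(h)\<close> over all vertices (\<open>variance_le_sum_Ramanujan_Q\<close>).

Now let each vertex of \<open>W\<close> join the side of \<open>A\<close> exactly when \<open>A\<close> contains more than half of its neighbours. A vertex in
\<open>B\<close> is charged for its edges to \<open>A\<close> and pays at most 1 for each, because \<open>Q(h) \<le> h\<close>; this gives the edge boundary.
A vertex in \<open>W\<close> is charged for at most \<open>n / 2\<close> edges and pays at most \<open>sqrt n\<close>, because
\<open>Q(h) \<le> sqrt (2 h)\<close>. The vertices of \<open>W\<close> that joined \<open>A\<close> make the mean of \<open>f\<close> nonzero, but the resulting loss is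
quadratic in their measure and is covered by the slack in their own bound
(\<open>Pow_partition_isoperimetry\<close>). Vertices are represented by subsets of the set of coordinates,
so that flipping becomes a symmetric difference.
\<close>

section \<open>Abel's identity\<close>

lemma sum_alternating_choose_Suc:
  fixes g :: "nat \<Rightarrow> real"
  shows "(\<Sum>v\<le>Suc h. (-1) ^ (Suc h - v) * real (Suc h choose v) * g v)
       = (\<Sum>v\<le>h. (-1) ^ (h - v) * real (h choose v) * (g (Suc v) - g v))"
proof -
  have first: "(\<Sum>v\<le>Suc h. (-1) ^ (Suc h - v) * real (Suc h choose v) * g v)
      = (-1) ^ Suc h * g 0 + (\<Sum>v\<le>h. (-1) ^ (h - v) * real (Suc h choose Suc v) * g (Suc v))"
    by (subst sum.atMost_Suc_shift) simp
  have second: "(\<Sum>v\<le>h. (-1) ^ (h - v) * real (Suc h choose Suc v) * g (Suc v))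
      = (\<Sum>v\<le>h. (-1) ^ (h - v) * real (h choose v) * g (Suc v))
        + (\<Sum>v\<le>h. (-1) ^ (h - v) * real (h choose Suc v) * g (Suc v))"
    by (simp add: sum.distrib[symmetric] algebra_simps)
  have "(\<Sum>v\<le>h. (-1) ^ (h - v) * real (h choose Suc v) * g (Suc v)) + (-1) ^ Suc h * g 0
      = (\<Sum>v\<le>Suc h. (-1) ^ (Suc h - v) * real (h choose v) * g v)"
    by (subst sum.atMost_Suc_shift) simp
  also have "\<dots> = - (\<Sum>v\<le>h. (-1) ^ (h - v) * real (h choose v) * g v)"
    by (simp add: sum_negf[symmetric] Suc_diff_le)
  finally have "(\<Sum>v\<le>h. (-1) ^ (h - v) * real (h choose Suc v) * g (Suc v)) + (-1) ^ Suc h * g 0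
      = - (\<Sum>v\<le>h. (-1) ^ (h - v) * real (h choose v) * g v)" .
  with first second show ?thesis
    by (simp add: right_diff_distrib sum_subtractf)
qed

text \<open>The step from \<open>h\<close> to \<open>h + 1\<close> uses that the \<open>h\<close>-th difference of \<open>x ^ (h + 1)\<close> has the
constant derivative \<open>(h + 1)!\<close>; taking one more difference with step 1 returns that constant.\<close>

lemma finite_difference_power:
  "(\<Sum>v\<le>h. (-1) ^ (h - v) * real (h choose v) * (x + real v) ^ h) = fact h"
proof (induction h arbitrary: x)
  case 0
  then show ?case by simp
next
  case (Suc h)
  let ?G = "\<lambda>x::real. \<Sum>v\<le>h. (-1) ^ (h - v) * real (h choose v) * (x + real v) ^ Suc h"
  have G': "(?G has_real_derivative real (Suc h) * fact h) (at z)" for z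
  proof -
    have "(?G has_real_derivative
        (\<Sum>v\<le>h. (-1) ^ (h - v) * real (h choose v) * (real (Suc h) * (z + real v) ^ h))) (at z)"
      by (auto intro!: derivative_eq_intros sum.cong simp del: power_Suc)
    moreover have "(\<Sum>v\<le>h. (-1) ^ (h - v) * real (h choose v) * (real (Suc h) * (z + real v) ^ h))
        = real (Suc h) * fact h"
      unfolding Suc.IH[of z, symmetric] by (simp only: sum_distrib_left mult_ac)
    ultimately show ?thesis by simp
  qed
  have "\<exists>z. x < z \<and> z < x + 1 \<and> ?G (x + 1) - ?G x = (x + 1 - x) * (real (Suc h) * fact h)"
    by (rule MVT2) (use G' in auto)
  then have "?G (x + 1) - ?G x = fact (Suc h)"
    by (auto simp: algebra_simps)
  then show ?case
    unfolding sum_alternating_choose_Suc by (simp add: algebra_simps sum_subtractf)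
qed

text \<open>By induction both sides have the same derivative in \<open>y\<close>, namely \<open>h\<close> times the identity for
\<open>h - 1\<close>. So it suffices to compare them at the single point \<open>y = - x\<close>, where the right-hand side is
\<open>h!\<close> and the left-hand side becomes the \<open>h\<close>-th difference of an \<open>h\<close>-th power.\<close>

theorem Abel_Hurwitz_identity:
  fixes x y :: real
  shows "(\<Sum>v\<le>h. real (h choose v) * (x + real v) ^ v * (y - real v) ^ (h - v))
       = (\<Sum>k\<le>h. fact h / fact k * (x + y) ^ k)"
proof (induction h arbitrary: y)
  case 0
  then show ?case by simp
next
  case (Suc h)
  let ?F = "\<lambda>y. \<Sum>v\<le>Suc h. real (Suc h choose v) * (x + real v) ^ v * (y - real v) ^ (Suc h - v)"
  let ?R = "\<lambda>y. \<Sum>k\<le>Suc h. fact (Suc h) / fact k * (x + y) ^ k"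
  let ?d = "\<lambda>z. real (Suc h) * (\<Sum>v\<le>h. real (h choose v) * (x + real v) ^ v * (z - real v) ^ (h - v))"
  have F': "(?F has_real_derivative ?d z) (at z)" for z
  proof -
    have F1: "(?F has_real_derivative (\<Sum>v\<le>Suc h. real (Suc h choose v) * (x + real v) ^ v *
        (real (Suc h - v) * (z - real v) ^ (Suc h - v - 1)))) (at z)"
      by (auto intro!: derivative_eq_intros sum.cong)
    have absorb: "real (Suc h choose v) * real (Suc h - v) = real (Suc h) * real (h choose v)" for v
      using binomial_absorb_comp[of "Suc h" v]
      unfolding of_nat_mult[symmetric] by (metis diff_Suc_1 mult.commute)
    have "(\<Sum>v\<le>Suc h. real (Suc h choose v) * (x + real v) ^ v *
        (real (Suc h - v) * (z - real v) ^ (Suc h - v - 1)))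
      = (\<Sum>v\<le>Suc h. (real (Suc h choose v) * real (Suc h - v)) * ((x + real v) ^ v * (z - real v) ^ (h - v)))"
      by (intro sum.cong) simp_all
    also have "\<dots> = ?d z"
      unfolding absorb by (simp add: sum_distrib_left mult_ac)
    finally have "(\<Sum>v\<le>Suc h. real (Suc h choose v) * (x + real v) ^ v *
        (real (Suc h - v) * (z - real v) ^ (Suc h - v - 1))) = ?d z" .
    with F1 show ?thesis by simp
  qed
  have R': "(?R has_real_derivative ?d z) (at z)" for z
  proof -
    have "(?R has_real_derivative
        (\<Sum>k\<le>Suc h. fact (Suc h) / fact k * (real k * (x + z) ^ (k - 1)))) (at z)"
      by (auto intro!: derivative_eq_intros sum.cong simp del: sum.atMost_Suc fact_Suc)
    also have "(\<Sum>k\<le>Suc h. fact (Suc h) / fact k * (real k * (x + z) ^ (k - 1)))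
        = real (Suc h) * (\<Sum>k\<le>h. fact h / fact k * (x + z) ^ k)"
      by (subst sum.atMost_Suc_shift) (simp add: sum_distrib_left divide_simps mult_ac)
    finally show ?thesis unfolding Suc.IH[of z] .
  qed
  have "((\<lambda>y. ?F y - ?R y) has_real_derivative 0) (at z)" for z
    using DERIV_diff[OF F' R'] by simp
  then have "?F y - ?R y = ?F (- x) - ?R (- x)"
    using DERIV_isconst_all by blast
  moreover have "?F (- x) = fact (Suc h)"
  proof -
    have "?F (- x) = (\<Sum>v\<le>Suc h. (-1) ^ (Suc h - v) * real (Suc h choose v) * (x + real v) ^ Suc h)"
    proof (rule sum.cong[OF refl])
      fix v assume "v \<in> {..Suc h}"
      then have "(x + real v) ^ v * (x + real v) ^ (Suc h - v) = (x + real v) ^ Suc h"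
        by (simp add: power_add[symmetric])
      moreover have "(- x - real v) ^ (Suc h - v) = (-1) ^ (Suc h - v) * (x + real v) ^ (Suc h - v)"
        by (simp add: power_mult_distrib[symmetric])
      ultimately show "real (Suc h choose v) * (x + real v) ^ v * (- x - real v) ^ (Suc h - v)
          = (-1) ^ (Suc h - v) * real (Suc h choose v) * (x + real v) ^ Suc h"
        by (simp add: mult_ac)
    qed
    then show ?thesis by (simp only: finite_difference_power)
  qed
  moreover have "?R (- x) = fact (Suc h)"
    by (subst sum.atMost_Suc_shift) simp
  ultimately show ?case by simp
qed

section \<open>The Ramanujan Q-function\<close>

text \<open>The \<open>k\<close>-th product is the probability that \<open>k\<close> random people have distinct birthdays in a year
of \<open>h\<close> days.\<close>

definition Ramanujan_Q :: "nat \<Rightarrow> real" where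
  "Ramanujan_Q h = (\<Sum>k=1..h. \<Prod>i<k. 1 - real i / real h)"

text \<open>Each summand is the largest value over \<open>q\<close> of the Bernstein polynomial
\<open>(h choose m) q ^ m (1 - q) ^ (h - m)\<close>, attained at \<open>q = m / h\<close>. Multiplied by \<open>h ^ h\<close>, the sum is the
left-hand side of Abel's identity for \<open>x = 0\<close> and \<open>y = h\<close>, and the terms on the other side are the
birthday probabilities in reverse order.\<close>

lemma sum_binomial_peaks:
  assumes "h \<ge> 1"
  shows "(\<Sum>m\<le>h. real (h choose m) * ((real m / real h) ^ m * (real (h - m) / real h) ^ (h - m)))
       = 1 + Ramanujan_Q h"
proof -
  have prod: "(\<Prod>i<k. 1 - real i / real h) = fact h / (fact (h - k) * real h ^ k)" if "k \<le> h" for k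
    using that
  proof (induction k)
    case (Suc k)
    have "fact (h - k) = real (h - k) * fact (h - Suc k)"
      using Suc.prems fact_reduce[of "h - k", where 'a = real] by simp
    moreover have "1 - real k / real h = real (h - k) / real h"
      using Suc.prems assms by (simp add: of_nat_diff diff_divide_distrib)
    ultimately show ?case using Suc assms by simp
  qed simp
  have "(\<Sum>m\<le>h. real (h choose m) * ((real m / real h) ^ m * (real (h - m) / real h) ^ (h - m)))
      = (\<Sum>m\<le>h. real (h choose m) * (0 + real m) ^ m * (real h - real m) ^ (h - m)) / real h ^ h"
    unfolding sum_divide_distrib
    by (intro sum.cong) (auto simp: power_divide of_nat_diff power_add[symmetric])
  also have "\<dots> = (\<Sum>k\<le>h. fact h / fact k * real h ^ k / real h ^ h)"
    unfolding Abel_Hurwitz_identity by (simp add: sum_divide_distrib)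
  also have "\<dots> = (\<Sum>k\<le>h. fact h / fact (h - k) * real h ^ (h - k) / real h ^ h)"
    by (rule sum.reindex_bij_witness[of _ "\<lambda>k. h - k" "\<lambda>k. h - k"]) auto
  also have "\<dots> = (\<Sum>k\<le>h. \<Prod>i<k. 1 - real i / real h)"
  proof (rule sum.cong[OF refl])
    fix k assume "k \<in> {..h}"
    then have "real h ^ h = real h ^ (h - k) * real h ^ k"
      by (simp add: power_add[symmetric])
    with \<open>k \<in> {..h}\<close> assms
    show "fact h / fact (h - k) * real h ^ (h - k) / real h ^ h = (\<Prod>i<k. 1 - real i / real h)"
      by (simp add: prod)
  qed
  also have "\<dots> = 1 + Ramanujan_Q h"
    unfolding Ramanujan_Q_def by (simp add: atMost_atLeast0 sum.atLeast_Suc_atMost)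
  finally show ?thesis .
qed

text \<open>In the expansion of the square, the pairs whose larger index is \<open>k\<close> contribute at most
\<open>2 (k - 1) + 1\<close> times \<open>a k\<close>, because all the entries are at most 1.\<close>

lemma square_sum_le_weighted_sum:
  fixes a :: "nat \<Rightarrow> real"
  assumes "\<And>k. k \<in> {1..h} \<Longrightarrow> 0 \<le> a k \<and> a k \<le> 1"
  shows "(\<Sum>k=1..h. a k)\<^sup>2 \<le> (\<Sum>k=1..h. (2 * real k - 1) * a k)"
  using assms
proof (induction h)
  case (Suc h)
  let ?s = "\<Sum>k=1..h. a k"
  have a: "0 \<le> a (Suc h)" "a (Suc h) \<le> 1" using Suc.prems by auto
  have "?s \<le> (\<Sum>k=1..h. 1)" using Suc.prems by (intro sum_mono) auto
  then have "?s * a (Suc h) \<le> real h * a (Suc h)"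
    using a by (intro mult_right_mono) auto
  moreover have "a (Suc h) * a (Suc h) \<le> 1 * a (Suc h)"
    using a by (intro mult_right_mono) auto
  moreover have "?s\<^sup>2 \<le> (\<Sum>k=1..h. (2 * real k - 1) * a k)"
    using Suc by auto
  ultimately show ?case by (simp add: power2_eq_square algebra_simps)
qed simp

text \<open>The birthday probabilities satisfy \<open>k a_k = h (a_k - a_(k+1))\<close>, so \<open>\<Sum> k a_k\<close> telescopes to \<open>h\<close>,
and the quadratic bound is the previous lemma. It says that \<open>Q(h)\<close> is at most about
\<open>sqrt (2 h) - 1/2\<close>. The true size is \<open>sqrt (\<pi> h / 2)\<close>; the factor 2 in place of \<open>\<pi> / 2\<close> is exactly
what a vertex with at most \<open>n / 2\<close> cut edges can afford.\<close>

lemma Ramanujan_Q_bounds: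
  shows Ramanujan_Q_le: "Ramanujan_Q h \<le> real h"
    and Ramanujan_Q_quadratic: "(Ramanujan_Q h)\<^sup>2 + Ramanujan_Q h \<le> 2 * real h"
    and Ramanujan_Q_nonneg: "0 \<le> Ramanujan_Q h"
proof -
  define a where "a k = (\<Prod>i<k. 1 - real i / real h)" for k
  have Q: "Ramanujan_Q h = (\<Sum>k=1..h. a k)" by (simp add: Ramanujan_Q_def a_def)
  have a: "0 \<le> a k \<and> a k \<le> 1" if "k \<in> {1..h}" for k
    unfolding a_def using that by (intro conjI prod_nonneg prod_le_1) (auto simp: divide_simps)
  show "0 \<le> Ramanujan_Q h" unfolding Q using a by (intro sum_nonneg) auto
  have "(\<Sum>k=1..h. a k) \<le> (\<Sum>k=1..h. 1)" using a by (intro sum_mono) auto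
  then show "Ramanujan_Q h \<le> real h" by (simp add: Q)
  have "(\<Sum>k=1..h. real k * a k) = real h"
  proof (cases "h = 0")
    case False
    have "(\<Sum>k=1..h. real k * a k) = (\<Sum>k=1..h. real h * (a k - a (Suc k)))"
      by (intro sum.cong) (use False in \<open>auto simp: a_def field_simps\<close>)
    also have "\<dots> = real h * (a 1 - a (Suc h))"
      using sum_Suc_diff[of 1 h "\<lambda>k. - a k"] False by (simp add: sum_distrib_left[symmetric])
    also have "\<dots> = real h" using False by (simp add: a_def)
    finally show ?thesis .
  qed simp
  moreover have "(\<Sum>k=1..h. (2 * real k - 1) * a k) = 2 * (\<Sum>k=1..h. real k * a k) - Ramanujan_Q h"
    unfolding Q sum_distrib_left sum_subtractf[symmetric] by (simp add: algebra_simps)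
  ultimately show "(Ramanujan_Q h)\<^sup>2 + Ramanujan_Q h \<le> 2 * real h"
    using square_sum_le_weighted_sum[of h a] a by (simp add: Q)
qed

lemma Ramanujan_Q_le_sqrt:
  assumes "2 * real h \<le> n" shows "Ramanujan_Q h \<le> sqrt n"
proof (rule real_le_rsqrt)
  show "(Ramanujan_Q h)\<^sup>2 \<le> n"
    using Ramanujan_Q_quadratic[of h] Ramanujan_Q_nonneg[of h] assms by linarith
qed

text \<open>A strict minority of cut edges saves the additional \<open>1 / sqrt n\<close>, which pays for the imbalance of
the two sides of the cut in the final estimate.\<close>

lemma Ramanujan_Q_le_sqrt_minus:
  assumes "2 * real h + 1 \<le> n" shows "Ramanujan_Q h \<le> sqrt n - 1 / sqrt n"
proof (rule ccontr)
  define s where "s = sqrt n"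
  have s: "s \<ge> 1" "s\<^sup>2 = n" using assms by (auto simp: s_def)
  then have "s * (1 / s) = 1" by simp
  assume "\<not> ?thesis"
  then have gt: "s - 1 / s < Ramanujan_Q h" by (simp add: s_def)
  have nn: "0 \<le> s - 1 / s" using s by (simp add: field_simps) (metis s(1) mult_mono' mult_1 zero_le_one)
  \<comment> \<open>The map \<open>t \<mapsto> t\<^sup>2 + t\<close> is increasing on the nonnegative reals, so the quadratic bound is violated.\<close>
  have "(s - 1 / s)\<^sup>2 + (s - 1 / s) < (Ramanujan_Q h)\<^sup>2 + Ramanujan_Q h"
    using gt nn by (intro add_less_le_mono power_strict_mono) auto
  also have "\<dots> \<le> s\<^sup>2 - 1" using Ramanujan_Q_quadratic[of h] assms s by simp
  finally have "(s - 1 / s)\<^sup>2 + (s - 1 / s) < s\<^sup>2 - 1" .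
  moreover have "(s - 1 / s)\<^sup>2 + (s - 1 / s) - (s\<^sup>2 - 1) = (s - 1 / s) * (1 - 1 / s)"
    using \<open>s * (1 / s) = 1\<close> by algebra
  moreover have "(s - 1 / s) * (1 - 1 / s) \<ge> 0" using nn s by (intro mult_nonneg_nonneg) auto
  ultimately show False by linarith
qed

section \<open>The total variation of the Bernstein polynomials\<close>

definition power_product_deriv :: "nat \<Rightarrow> nat \<Rightarrow> real \<Rightarrow> real" where
  "power_product_deriv m k q =
     real m * q ^ (m - 1) * (1 - q) ^ k - real k * q ^ m * (1 - q) ^ (k - 1)"

lemma power_product_has_derivative:
  "((\<lambda>q. q ^ m * (1 - q) ^ k) has_real_derivative power_product_deriv m k q) (at q within A)"
  unfolding power_product_deriv_def by (auto intro!: derivative_eq_intros)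

text \<open>The function \<open>q ^ m (1 - q) ^ k\<close> increases up to \<open>q = m / (m + k)\<close> and decreases afterwards. The
additional hypothesis excludes \<open>q = 0\<close>, \<open>m = 0 < k\<close>, where the derivative is \<open>- k\<close>.\<close>

lemma power_product_deriv_sign:
  assumes "0 \<le> q" "q < 1"
  shows "k = 0 \<or> m > 0 \<Longrightarrow> q * real (m + k) \<le> real m \<Longrightarrow> 0 \<le> power_product_deriv m k q"
    and "real m \<le> q * real (m + k) \<Longrightarrow> power_product_deriv m k q \<le> 0"
proof -
  consider "m = 0" | "k = 0" | a b where "m = Suc a" "k = Suc b"
    by (metis not0_implies_Suc)
  then have "((k = 0 \<or> m > 0) \<and> q * real (m + k) \<le> real m \<longrightarrow> 0 \<le> power_product_deriv m k q)
      \<and> (real m \<le> q * real (m + k) \<longrightarrow> power_product_deriv m k q \<le> 0)"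
  proof cases
    case 1
    then show ?thesis using assms
      by (auto simp: power_product_deriv_def mult_le_0_iff power_0_left)
  next
    case 2
    then show ?thesis using assms
      by (auto simp: power_product_deriv_def mult_le_0_iff mult_le_cancel_right1)
  next
    case 3
    have eq: "power_product_deriv m k q
        = q ^ a * (1 - q) ^ b * (real m - q * real (m + k))"
      unfolding power_product_deriv_def 3 by (simp add: algebra_simps)
    have "0 \<le> q ^ a * (1 - q) ^ b" using assms by simp
    then show ?thesis unfolding eq
      by (auto intro: mult_nonneg_nonneg mult_nonneg_nonpos)
  qed
  then show "k = 0 \<or> m > 0 \<Longrightarrow> q * real (m + k) \<le> real m \<Longrightarrow> 0 \<le> power_product_deriv m k q"
    and "real m \<le> q * real (m + k) \<Longrightarrow> power_product_deriv m k q \<le> 0"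
    by blast+
qed

text \<open>The total variation of \<open>q ^ m (1 - q) ^ k\<close> on \<open>[0, 1/2]\<close>: for \<open>k \<le> m\<close> the function is increasing there,
otherwise it climbs to its peak inside the interval and descends again. Since \<open>0 ^ 0 = 1\<close>, the term
\<open>0 ^ m\<close> is the value at \<open>q = 0\<close>.\<close>

definition half_variation :: "nat \<Rightarrow> nat \<Rightarrow> real" where
  "half_variation m k =
     (if k \<le> m then (1/2) ^ (m + k) - 0 ^ m
      else 2 * ((real m / real (m + k)) ^ m * (real k / real (m + k)) ^ k) - 0 ^ m - (1/2) ^ (m + k))"

lemma has_integral_abs_power_product_deriv:
  "((\<lambda>q. \<bar>power_product_deriv m k q\<bar>) has_integral half_variation m k) {0..1/2}"
proof -
  let ?b = "\<lambda>q::real. q ^ m * (1 - q) ^ k" and ?d = "power_product_deriv m k"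
  have ftc: "(?d has_integral (?b v - ?b u)) {u..v}" if "u \<le> v" for u v
    using that power_product_has_derivative
    by (intro fundamental_theorem_of_calculus)
       (auto simp: has_real_derivative_iff_has_vector_derivative[symmetric])
  have half: "?b (1/2) = (1/2) ^ (m + k)" by (simp add: power_add)
  show ?thesis
  proof (cases "k \<le> m")
    case True
    have "\<bar>?d q\<bar> = ?d q" if "q \<in> {0..1/2}" for q
    proof -
      have "q * real (m + k) \<le> 1/2 * real (m + k)" using that by (intro mult_right_mono) auto
      also have "\<dots> \<le> real m" using True by simp
      finally have "0 \<le> ?d q"
        using power_product_deriv_sign(1)[of q k m] that True by auto
      then show ?thesis by simp
    qed
    with ftc[of 0 "1/2"] have "((\<lambda>q. \<bar>?d q\<bar>) has_integral (?b (1/2) - ?b 0)) {0..1/2}"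
      by (subst has_integral_cong) auto
    then show ?thesis using True half by (simp add: half_variation_def)
  next
    case False
    define p where "p = real m / real (m + k)"
    have p: "0 \<le> p" "p \<le> 1/2" "p * real (m + k) = real m" "1 - p = real k / real (m + k)"
      using False by (auto simp: p_def divide_simps)
    have left: "\<bar>?d q\<bar> = ?d q" if "q \<in> {0..p}" "m > 0" for q
    proof -
      have "q * real (m + k) \<le> p * real (m + k)" using that by (intro mult_right_mono) auto
      then have "0 \<le> ?d q"
        unfolding p(3) using that p(2) by (intro power_product_deriv_sign(1)) auto
      then show ?thesis by simp
    qed
    have right: "\<bar>?d q\<bar> = - ?d q" if "q \<in> {p..1/2}" for q
    proof -
      have "p * real (m + k) \<le> q * real (m + k)" using that by (intro mult_right_mono) auto
      then have "?d q \<le> 0"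
        unfolding p(3) using that p(1) by (intro power_product_deriv_sign(2)) auto
      then show ?thesis by simp
    qed
    have "((\<lambda>q. \<bar>?d q\<bar>) has_integral (?b p - ?b 0)) {0..p}"
    proof (cases "m = 0")
      case True
      then show ?thesis by (simp add: p_def has_integral_refl)
    next
      case False
      then show ?thesis using ftc[of 0 p] p(1) left by (subst has_integral_cong) auto
    qed
    moreover have "((\<lambda>q. \<bar>?d q\<bar>) has_integral - (?b (1/2) - ?b p)) {p..1/2}"
      using has_integral_neg[OF ftc[of p "1/2"]] p(2) right by (subst has_integral_cong) auto
    ultimately have "((\<lambda>q. \<bar>?d q\<bar>) has_integral (?b p - ?b 0) + - (?b (1/2) - ?b p)) {0..1/2}"
      by (rule has_integral_combine[OF p(1,2)])
    moreover have "(?b p - ?b 0) + - (?b (1/2) - ?b p) = half_variation m k"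
      using False half by (simp add: half_variation_def p(4)) (simp add: p_def)
    ultimately show ?thesis by simp
  qed
qed

text \<open>The reflection \<open>q \<mapsto> 1 - q\<close> exchanges \<open>m\<close> and \<open>k\<close>, so this is the variation of one function on all of
\<open>[0, 1]\<close>; the values at \<open>q = 1/2\<close> cancel.\<close>

lemma half_variation_symmetric_sum:
  assumes "m + k \<ge> 1"
  shows "half_variation m k + half_variation k m
       = 2 * ((real m / real (m + k)) ^ m * (real k / real (m + k)) ^ k) - 0 ^ m - 0 ^ k"
proof (cases "m = k")
  case True
  then have "real m / real (m + m) = 1/2" using assms by simp
  then show ?thesis using True by (simp add: half_variation_def power_add)
next
  case False
  then show ?thesis by (auto simp: half_variation_def add.commute mult.commute)
qed

definition Bernstein_variation :: "nat \<Rightarrow> real \<Rightarrow> real" where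
  "Bernstein_variation h q =
     (\<Sum>m\<le>h. real (h choose m) * \<bar>power_product_deriv m (h - m) q\<bar>)"

text \<open>Pairing \<open>m\<close> with \<open>h - m\<close> leaves one peak value for each \<open>m\<close>, and the boundary terms of \<open>m = 0\<close>
and \<open>m = h\<close> remove 1. The sum of the peaks is \<open>1 + Q(h)\<close>.\<close>

theorem has_integral_Bernstein_variation:
  "(Bernstein_variation h has_integral Ramanujan_Q h) {0..1/2}"
proof (cases "h = 0")
  case True
  have "Bernstein_variation 0 = (\<lambda>q. 0)"
    by (auto simp: Bernstein_variation_def power_product_deriv_def)
  then show ?thesis using True by (simp add: Ramanujan_Q_def)
next
  case False
  let ?V = "\<lambda>m. half_variation m (h - m)"
  let ?peak = "\<lambda>m. (real m / real h) ^ m * (real (h - m) / real h) ^ (h - m)"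
  have "(\<Sum>m\<le>h. real (h choose m) * ?V m) = (\<Sum>m\<le>h. real (h choose m) * half_variation (h - m) m)"
    by (rule sum.reindex_bij_witness[of _ "\<lambda>m. h - m" "\<lambda>m. h - m"]) (auto simp: binomial_symmetric[symmetric])
  then have "2 * (\<Sum>m\<le>h. real (h choose m) * ?V m)
      = (\<Sum>m\<le>h. real (h choose m) * (?V m + half_variation (h - m) m))"
    by (simp add: distrib_left sum.distrib)
  also have "\<dots> = (\<Sum>m\<le>h. real (h choose m) * (2 * ?peak m - 0 ^ m - 0 ^ (h - m)))"
  proof (rule sum.cong[OF refl])
    fix m assume "m \<in> {..h}"
    with False have "m + (h - m) = h" "1 \<le> m + (h - m)" by auto
    then show "real (h choose m) * (?V m + half_variation (h - m) m)
        = real (h choose m) * (2 * ?peak m - 0 ^ m - 0 ^ (h - m))"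
      using half_variation_symmetric_sum[of m "h - m"] by simp
  qed
  also have "\<dots> = 2 * (\<Sum>m\<le>h. real (h choose m) * ?peak m)
      - (\<Sum>m\<le>h. real (h choose m) * 0 ^ m) - (\<Sum>m\<le>h. real (h choose m) * 0 ^ (h - m))"
    by (simp add: right_diff_distrib sum_subtractf sum_distrib_left mult_ac)
  also have "(\<Sum>m\<le>h. real (h choose m) * 0 ^ m) = 1"
    using binomial_ring[of "0::real" 1 h] by simp
  also have "(\<Sum>m\<le>h. real (h choose m) * 0 ^ (h - m)) = 1"
    using binomial_ring[of "1::real" 0 h] by simp
  finally have "(\<Sum>m\<le>h. real (h choose m) * ?V m) = Ramanujan_Q h"
    using sum_binomial_peaks[of h] False by simp
  moreover have "(Bernstein_variation h has_integral (\<Sum>m\<le>h. real (h choose m) * ?V m)) {0..1/2}"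
    unfolding Bernstein_variation_def
    by (intro has_integral_sum has_integral_mult_right has_integral_abs_power_product_deriv) auto
  ultimately show ?thesis by simp
qed

section \<open>Noise on the cube of subsets\<close>

lemma sum_Pow_Un:
  fixes g :: "'a set \<Rightarrow> real"
  assumes "S \<inter> T = {}"
  shows "(\<Sum>D\<in>Pow (S \<union> T). g D) = (\<Sum>E\<in>Pow S. \<Sum>F\<in>Pow T. g (E \<union> F))"
proof -
  have 1: "D \<inter> S \<union> D \<inter> T = D" if "D \<in> Pow (S \<union> T)" for D
    using that by auto
  have 2: "(E \<union> F) \<inter> S = E" "(E \<union> F) \<inter> T = F" if "E \<in> Pow S" "F \<in> Pow T" for E F
    using that assms by auto
  have "bij_betw (\<lambda>(E, F). E \<union> F) (Pow S \<times> Pow T) (Pow (S \<union> T))"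
    by (rule bij_betw_byWitness[where f' = "\<lambda>D. (D \<inter> S, D \<inter> T)"])
       (simp_all add: 1 2 split_beta image_subset_iff le_infI2 le_supI1 le_supI2)
  from sum.reindex_bij_betw[OF this, of g] show ?thesis
    by (simp add: sum.cartesian_product split_beta)
qed

lemma sum_Pow_card:
  fixes g :: "nat \<Rightarrow> real"
  assumes "finite S"
  shows "(\<Sum>D\<in>Pow S. g (card D)) = (\<Sum>m\<le>card S. real (card S choose m) * g m)"
proof -
  have "(\<Sum>D\<in>Pow S. g (card D)) = (\<Sum>m\<le>card S. \<Sum>D\<in>{D \<in> Pow S. card D = m}. g (card D))"
    using assms by (intro sum.group[symmetric]) (auto simp: card_mono)
  also have "\<dots> = (\<Sum>m\<le>card S. real (card S choose m) * g m)"
    using n_subsets[OF assms] by (intro sum.cong) (auto simp: Pow_def)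
  finally show ?thesis .
qed

text \<open>The probability that the set of flipped coordinates is \<open>D\<close> when every coordinate in \<open>I\<close> is
flipped independently with probability \<open>q\<close>.\<close>

definition noise_weight :: "'a set \<Rightarrow> real \<Rightarrow> 'a set \<Rightarrow> real" where
  "noise_weight I q D = q ^ card D * (1 - q) ^ (card I - card D)"

lemma noise_weight_nonneg: "0 \<le> q \<Longrightarrow> q \<le> 1 \<Longrightarrow> 0 \<le> noise_weight I q D"
  by (simp add: noise_weight_def)

lemma noise_weight_Un:
  assumes "finite S" "finite T" "S \<inter> T = {}" "E \<subseteq> S" "F \<subseteq> T"
  shows "noise_weight (S \<union> T) q (E \<union> F) = noise_weight S q E * noise_weight T q F"
proof -
  have "card (S \<union> T) = card S + card T" "card (E \<union> F) = card E + card F"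
    using assms by (auto intro!: card_Un_disjoint intro: finite_subset)
  moreover have "card E \<le> card S" "card F \<le> card T" using assms by (auto intro: card_mono)
  ultimately have "card (S \<union> T) - card (E \<union> F) = (card S - card E) + (card T - card F)"
    and "card (E \<union> F) = card E + card F" by auto
  then show ?thesis by (simp only: noise_weight_def power_add mult_ac)
qed

lemma sum_noise_weight:
  assumes "finite S" shows "(\<Sum>D\<in>Pow S. noise_weight S q D) = 1"
  unfolding noise_weight_def
  using sum_Pow_card[OF assms, of "\<lambda>m. q ^ m * (1 - q) ^ (card S - m)"]
    binomial_ring[of q "1 - q" "card S"] by (simp add: mult.assoc)

text \<open>The contribution of the coordinate \<open>j\<close> to minus the derivative of \<open>noise_weight I q D\<close> in \<open>q\<close>. The coordinate
\<open>j\<close> itself is removed from the weight, so that the two sets \<open>D\<close> that differ only in \<open>j\<close> carry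
opposite values.\<close>

definition signed_weight :: "'a set \<Rightarrow> real \<Rightarrow> 'a \<Rightarrow> 'a set \<Rightarrow> real" where
  "signed_weight I q j D = (if j \<in> D then - 1 else 1) * noise_weight (I - {j}) q (D - {j})"

lemma sum_signed_weight:
  assumes "finite I" "D \<subseteq> I"
  shows "(\<Sum>j\<in>I. signed_weight I q j D) = - power_product_deriv (card D) (card I - card D) q"
proof -
  have fin: "finite D" using assms finite_subset by blast
  have "(\<Sum>j\<in>I. signed_weight I q j D)
      = (\<Sum>j\<in>I - D. signed_weight I q j D) + (\<Sum>j\<in>D. signed_weight I q j D)"
    by (rule sum.subset_diff[OF assms(2,1)])
  also have "(\<Sum>j\<in>I - D. signed_weight I q j D)
      = (\<Sum>j\<in>I - D. q ^ card D * (1 - q) ^ (card I - card D - 1))"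
    using assms by (intro sum.cong)
      (auto simp: signed_weight_def noise_weight_def card_Diff_singleton)
  also have "(\<Sum>j\<in>D. signed_weight I q j D)
      = (\<Sum>j\<in>D. - (q ^ (card D - 1) * (1 - q) ^ (card I - card D)))"
  proof (rule sum.cong[OF refl])
    fix j assume j: "j \<in> D"
    then have "card D > 0" "card (I - {j}) - card (D - {j}) = card I - card D"
      using fin assms card_gt_0_iff[of D] by (auto simp: card_Diff_singleton subset_iff)
    then show "signed_weight I q j D = - (q ^ (card D - 1) * (1 - q) ^ (card I - card D))"
      using j fin by (simp add: signed_weight_def noise_weight_def card_Diff_singleton)
  qed
  finally show ?thesis
    using assms fin by (simp add: power_product_deriv_def card_Diff_subset algebra_simps)
qed

lemma noise_weight_has_derivative:
  assumes "finite I" "D \<subseteq> I"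
  shows "((\<lambda>q. noise_weight I q D) has_real_derivative - (\<Sum>j\<in>I. signed_weight I q j D)) (at q within A)"
  using power_product_has_derivative[of "card D" "card I - card D"]
  unfolding sum_signed_weight[OF assms] noise_weight_def by simp

text \<open>For \<open>j \<in> S\<close> the weight factors into a part on \<open>S\<close> and a probability on \<open>I - S\<close>. The latter sums
to 1, and on \<open>S\<close> the sum over \<open>j\<close> is the full derivative of the weight, which depends only on
the cardinality of the set.\<close>

lemma sum_abs_sum_signed_weight:
  assumes "finite I" "S \<subseteq> I" "0 \<le> q" "q \<le> 1"
  shows "(\<Sum>D\<in>Pow I. \<bar>\<Sum>j\<in>S. signed_weight I q j D\<bar>) = Bernstein_variation (card S) q"
proof -
  define T where "T = I - S"
  have T: "I = S \<union> T" "S \<inter> T = {}" "finite S" "finite T"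
    using assms finite_subset by (auto simp: T_def)
  have split: "signed_weight I q j (E \<union> F) = signed_weight S q j E * noise_weight T q F"
    if "E \<in> Pow S" "F \<in> Pow T" "j \<in> S" for E F j
  proof -
    have "I - {j} = (S - {j}) \<union> T" "(E \<union> F) - {j} = (E - {j}) \<union> F" "j \<in> E \<union> F \<longleftrightarrow> j \<in> E"
      using that T by auto
    moreover have "noise_weight ((S - {j}) \<union> T) q ((E - {j}) \<union> F)
        = noise_weight (S - {j}) q (E - {j}) * noise_weight T q F"
      using that T(2-4) by (intro noise_weight_Un) auto
    ultimately show ?thesis by (simp only: signed_weight_def mult.assoc)
  qed
  have "(\<Sum>D\<in>Pow I. \<bar>\<Sum>j\<in>S. signed_weight I q j D\<bar>)
      = (\<Sum>E\<in>Pow S. \<Sum>F\<in>Pow T. \<bar>\<Sum>j\<in>S. signed_weight I q j (E \<union> F)\<bar>)"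
    unfolding T(1) by (rule sum_Pow_Un[OF T(2)])
  also have "\<dots> = (\<Sum>E\<in>Pow S. \<Sum>F\<in>Pow T. \<bar>\<Sum>j\<in>S. signed_weight S q j E\<bar> * noise_weight T q F)"
    by (intro sum.cong refl)
      (simp add: split sum_distrib_right[symmetric] abs_mult abs_of_nonneg[OF noise_weight_nonneg[OF assms(3,4)]])
  also have "\<dots> = (\<Sum>E\<in>Pow S. \<bar>\<Sum>j\<in>S. signed_weight S q j E\<bar>)"
    using sum_noise_weight[OF T(4)] by (simp add: sum_distrib_left[symmetric])
  also have "\<dots> = (\<Sum>E\<in>Pow S. \<bar>power_product_deriv (card E) (card S - card E) q\<bar>)"
    using T(3) by (intro sum.cong refl) (simp add: sum_signed_weight)
  also have "\<dots> = Bernstein_variation (card S) q"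
    unfolding Bernstein_variation_def by (rule sum_Pow_card[OF T(3)])
  finally show ?thesis .
qed

text \<open>The flow that the noise sends along the edge from \<open>x\<close> in direction \<open>j\<close>: the difference between the averages of
\<open>f\<close> near \<open>x\<close> on the two sides of the coordinate \<open>j\<close>.\<close>

definition edge_flow :: "'a set \<Rightarrow> real \<Rightarrow> ('a set \<Rightarrow> real) \<Rightarrow> 'a \<Rightarrow> 'a set \<Rightarrow> real" where
  "edge_flow I q f j x = (\<Sum>D\<in>Pow I. signed_weight I q j D * f (sym_diff x D))"

lemma edge_flow_flip:
  assumes "j \<in> I"
  shows "edge_flow I q f j (sym_diff x {j}) = - edge_flow I q f j x"
proof -
  have "edge_flow I q f j (sym_diff x {j})
      = (\<Sum>D\<in>Pow I. signed_weight I q j (sym_diff D {j}) * f (sym_diff x D))"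
    unfolding edge_flow_def
    by (rule sum.reindex_bij_witness[of _ "\<lambda>D. sym_diff D {j}" "\<lambda>D. sym_diff D {j}"])
       (use assms in \<open>auto intro!: arg_cong2[of _ _ _ _ "(*)"] arg_cong[of _ _ f] arg_cong[of _ _ "signed_weight I q j"]\<close>)
  also have "\<dots> = (\<Sum>D\<in>Pow I. - (signed_weight I q j D * f (sym_diff x D)))"
  proof (rule sum.cong[OF refl])
    fix D
    have "sym_diff D {j} - {j} = D - {j}" "j \<in> sym_diff D {j} \<longleftrightarrow> j \<notin> D" by auto
    then have "signed_weight I q j (sym_diff D {j}) = - signed_weight I q j D"
      unfolding signed_weight_def by simp
    then show "signed_weight I q j (sym_diff D {j}) * f (sym_diff x D)
        = - (signed_weight I q j D * f (sym_diff x D))" by simp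
  qed
  finally show ?thesis by (simp add: edge_flow_def sum_negf)
qed

text \<open>This bound on the whole flow out of \<open>x\<close> through the directions in \<open>S\<close> is what beats the trivial
bound \<open>2 * card S\<close>: the single edges can each carry a large flow, but not all at the same
time, because the same function \<open>f\<close> enters all of them.\<close>

lemma abs_sum_edge_flow_le:
  assumes "finite I" "S \<subseteq> I" "0 \<le> q" "q \<le> 1" "\<And>y. \<bar>f y\<bar> \<le> 1"
  shows "\<bar>\<Sum>j\<in>S. edge_flow I q f j x\<bar> \<le> Bernstein_variation (card S) q"
proof -
  have "(\<Sum>j\<in>S. edge_flow I q f j x)
      = (\<Sum>D\<in>Pow I. (\<Sum>j\<in>S. signed_weight I q j D) * f (sym_diff x D))"
    unfolding edge_flow_def sum_distrib_right by (rule sum.swap)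
  also have "\<bar>\<dots>\<bar> \<le> (\<Sum>D\<in>Pow I. \<bar>(\<Sum>j\<in>S. signed_weight I q j D) * f (sym_diff x D)\<bar>)"
    by (rule sum_abs)
  also have "\<dots> \<le> (\<Sum>D\<in>Pow I. \<bar>\<Sum>j\<in>S. signed_weight I q j D\<bar> * 1)"
    unfolding abs_mult using assms(5) by (intro sum_mono mult_left_mono) auto
  finally show ?thesis
    using sum_abs_sum_signed_weight[OF assms(1-4)] by simp
qed

definition noise_correlation :: "'a set \<Rightarrow> ('a set \<Rightarrow> real) \<Rightarrow> real \<Rightarrow> real" where
  "noise_correlation I f q = (\<Sum>x\<in>Pow I. \<Sum>D\<in>Pow I. noise_weight I q D * (f x * f (sym_diff x D)))"

lemma noise_correlation_0:
  assumes "finite I"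
  shows "noise_correlation I f 0 = (\<Sum>x\<in>Pow I. (f x)\<^sup>2)"
  unfolding noise_correlation_def
proof (rule sum.cong[OF refl])
  fix x
  have "(\<Sum>D\<in>Pow I. noise_weight I 0 D * (f x * f (sym_diff x D)))
      = (\<Sum>D\<in>Pow I. if D = {} then f x * f x else 0)"
    using assms by (intro sum.cong refl)
      (auto simp: noise_weight_def power_0_left card_eq_0_iff dest: finite_subset)
  also have "\<dots> = (f x)\<^sup>2" using assms by (simp add: power2_eq_square)
  finally show "(\<Sum>D\<in>Pow I. noise_weight I 0 D * (f x * f (sym_diff x D))) = (f x)\<^sup>2" .
qed

lemma noise_correlation_half:
  assumes "finite I"
  shows "noise_correlation I f (1/2) = (\<Sum>x\<in>Pow I. f x)\<^sup>2 / 2 ^ card I"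
proof -
  have w: "noise_weight I (1/2) D = 1 / 2 ^ card I" if "D \<in> Pow I" for D
    using that assms by (simp add: noise_weight_def power_add[symmetric] card_mono power_one_over)
  have shift: "(\<Sum>D\<in>Pow I. f (sym_diff x D)) = (\<Sum>y\<in>Pow I. f y)" if "x \<in> Pow I" for x
    by (rule sum.reindex_bij_witness[of _ "\<lambda>D. sym_diff x D" "\<lambda>D. sym_diff x D"])
       (use that in \<open>auto intro!: arg_cong[of _ _ f]\<close>)
  have "noise_correlation I f (1/2)
      = (\<Sum>x\<in>Pow I. 1 / 2 ^ card I * f x * (\<Sum>D\<in>Pow I. f (sym_diff x D)))"
    unfolding noise_correlation_def sum_distrib_left
    by (intro sum.cong refl) (simp add: w)
  also have "\<dots> = (\<Sum>x\<in>Pow I. 1 / 2 ^ card I * f x * (\<Sum>y\<in>Pow I. f y))"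
    by (intro sum.cong refl) (simp only: shift)
  finally show ?thesis
    by (simp add: sum_distrib_right[symmetric] sum_divide_distrib[symmetric] power2_eq_square)
qed

lemma noise_correlation_has_derivative:
  assumes "finite I"
  shows "((\<lambda>q. - noise_correlation I f q) has_real_derivative
           (\<Sum>j\<in>I. \<Sum>x\<in>Pow I. f x * edge_flow I q f j x)) (at q within A)"
proof -
  have "((\<lambda>q. noise_correlation I f q) has_real_derivative
      (\<Sum>x\<in>Pow I. \<Sum>D\<in>Pow I. - (\<Sum>j\<in>I. signed_weight I q j D) * (f x * f (sym_diff x D)))) (at q within A)"
    unfolding noise_correlation_def
    by (intro DERIV_sum DERIV_cmult_right noise_weight_has_derivative assms) auto
  then have "((\<lambda>q. - noise_correlation I f q) has_real_derivative
      - (\<Sum>x\<in>Pow I. \<Sum>D\<in>Pow I. - (\<Sum>j\<in>I. signed_weight I q j D) * (f x * f (sym_diff x D)))) (at q within A)"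
    by (rule DERIV_minus)
  also have "- (\<Sum>x\<in>Pow I. \<Sum>D\<in>Pow I. - (\<Sum>j\<in>I. signed_weight I q j D) * (f x * f (sym_diff x D)))
      = (\<Sum>x\<in>Pow I. \<Sum>D\<in>Pow I. \<Sum>j\<in>I. signed_weight I q j D * (f x * f (sym_diff x D)))"
    by (simp add: sum_negf sum_distrib_right)
  also have "\<dots> = (\<Sum>x\<in>Pow I. \<Sum>j\<in>I. \<Sum>D\<in>Pow I. signed_weight I q j D * (f x * f (sym_diff x D)))"
    by (intro sum.cong refl sum.swap)
  also have "\<dots> = (\<Sum>x\<in>Pow I. \<Sum>j\<in>I. f x * edge_flow I q f j x)"
    by (simp add: edge_flow_def sum_distrib_left mult_ac)
  also have "\<dots> = (\<Sum>j\<in>I. \<Sum>x\<in>Pow I. f x * edge_flow I q f j x)"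
    by (rule sum.swap)
  finally show ?thesis .
qed

text \<open>An edge on which \<open>f\<close> is constant does not contribute, because its two flows cancel. On a cut edge
the value of \<open>f\<close> and the flow both change sign between the endpoints, so both endpoints contribute the same
amount, and the whole amount may be charged to either of them. The set \<open>S x\<close> collects the
directions of the edges that are charged to \<open>x\<close>.\<close>

lemma sum_edge_flow_charged:
  fixes f :: "'a set \<Rightarrow> real"
  assumes "j \<in> I"
    and sign: "\<And>x. f x = 1 \<or> f x = - 1"
    and once: "\<And>x. x \<subseteq> I \<Longrightarrow> f x \<noteq> f (sym_diff x {j}) \<Longrightarrow> j \<in> S x \<longleftrightarrow> j \<notin> S (sym_diff x {j})"
    and cut: "\<And>x. x \<subseteq> I \<Longrightarrow> j \<in> S x \<Longrightarrow> f x \<noteq> f (sym_diff x {j})"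
  shows "(\<Sum>x\<in>Pow I. f x * edge_flow I q f j x)
       = 2 * (\<Sum>x\<in>Pow I. if j \<in> S x then f x * edge_flow I q f j x else 0)"
proof -
  let ?w = "edge_flow I q f j" and ?n = "\<lambda>x. sym_diff x {j}"
  let ?t = "\<lambda>x. (f x - f (?n x)) * ?w x"
  let ?c = "\<lambda>x. if j \<in> S x then 1 else 0 :: real"
  have flip: "(\<Sum>x\<in>Pow I. g (?n x)) = (\<Sum>x\<in>Pow I. g x)" for g :: "'a set \<Rightarrow> real"
    by (rule sum.reindex_bij_witness[of _ ?n ?n]) (use assms(1) in \<open>auto intro!: arg_cong[of _ _ g]\<close>)
  have invol: "?n (?n x) = x" for x by auto
  have t_flip: "?t (?n x) = ?t x" for x
    unfolding invol edge_flow_flip[OF assms(1)] by (simp add: algebra_simps)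
  \<comment> \<open>Symmetrising over the two endpoints of each edge isolates the cut edges.\<close>
  have "2 * (\<Sum>x\<in>Pow I. f x * ?w x) = (\<Sum>x\<in>Pow I. f x * ?w x) + (\<Sum>x\<in>Pow I. f (?n x) * ?w (?n x))"
    using flip[of "\<lambda>x. f x * ?w x"] by simp
  also have "\<dots> = (\<Sum>x\<in>Pow I. ?t x)"
    unfolding sum.distrib[symmetric] edge_flow_flip[OF assms(1)] by (simp add: algebra_simps)
  also have "\<dots> = (\<Sum>x\<in>Pow I. ?t x * ?c x + ?t (?n x) * ?c (?n x))"
  proof (rule sum.cong[OF refl])
    fix x assume "x \<in> Pow I"
    then have "?t x = ?t x * (?c x + ?c (?n x))" using once[of x] by auto
    then show "?t x = ?t x * ?c x + ?t (?n x) * ?c (?n x)"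
      unfolding t_flip by (simp only: distrib_left)
  qed
  also have "\<dots> = 2 * (\<Sum>x\<in>Pow I. ?t x * ?c x)"
    using flip[of "\<lambda>x. ?t x * ?c x"] by (simp add: sum.distrib)
  also have "(\<Sum>x\<in>Pow I. ?t x * ?c x) = (\<Sum>x\<in>Pow I. 2 * (if j \<in> S x then f x * ?w x else 0))"
  proof (rule sum.cong[OF refl])
    fix x assume "x \<in> Pow I"
    then have "f (?n x) = - f x" if "j \<in> S x"
      using cut[of x] sign[of x] sign[of "?n x"] that by auto
    then show "?t x * ?c x = 2 * (if j \<in> S x then f x * ?w x else 0)" by auto
  qed
  finally show ?thesis by (simp only: sum_distrib_left[symmetric])
qed

text \<open>The correlation \<open>\<Sum>x. f x * E f (x with noise q)\<close> decreases from \<open>2 ^ n\<close> at \<open>q = 0\<close> to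
\<open>(\<Sum>x. f x)\<^sup>2 / 2 ^ n\<close> at \<open>q = 1/2\<close>, where the noisy point is uniform. The loss is the integral of the flows,
which are charged to the vertices; a vertex with \<open>h\<close> charged edges pays at most \<open>Q(h)\<close>. Equality holds
for a half cube when every vertex on one side is charged for its single cut edge.\<close>

theorem variance_le_sum_Ramanujan_Q:
  fixes f :: "'a set \<Rightarrow> real"
  assumes "finite I"
    and sign: "\<And>x. f x = 1 \<or> f x = - 1"
    and S: "\<And>x. x \<subseteq> I \<Longrightarrow> S x \<subseteq> I"
    and once: "\<And>x j. x \<subseteq> I \<Longrightarrow> j \<in> I \<Longrightarrow> f x \<noteq> f (sym_diff x {j}) \<Longrightarrow> j \<in> S x \<longleftrightarrow> j \<notin> S (sym_diff x {j})"
    and cut: "\<And>x j. x \<subseteq> I \<Longrightarrow> j \<in> S x \<Longrightarrow> f x \<noteq> f (sym_diff x {j})"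
  shows "2 ^ card I - (\<Sum>x\<in>Pow I. f x)\<^sup>2 / 2 ^ card I
       \<le> 2 * (\<Sum>x\<in>Pow I. Ramanujan_Q (card (S x)))"
proof -
  let ?d = "\<lambda>q. \<Sum>j\<in>I. \<Sum>x\<in>Pow I. f x * edge_flow I q f j x"
  have "(?d has_integral (- noise_correlation I f (1/2) - - noise_correlation I f 0)) {0..1/2}"
    using noise_correlation_has_derivative[OF assms(1)]
    by (intro fundamental_theorem_of_calculus)
       (auto simp: has_real_derivative_iff_has_vector_derivative[symmetric])
  moreover have "((\<lambda>q. 2 * (\<Sum>x\<in>Pow I. Bernstein_variation (card (S x)) q)) has_integral
      2 * (\<Sum>x\<in>Pow I. Ramanujan_Q (card (S x)))) {0..1/2}"
    using assms(1)
    by (intro has_integral_mult_right has_integral_sum has_integral_Bernstein_variation) auto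
  moreover have "?d q \<le> 2 * (\<Sum>x\<in>Pow I. Bernstein_variation (card (S x)) q)"
    if q: "q \<in> {0..1/2}" for q
  proof -
    have "?d q = (\<Sum>j\<in>I. 2 * (\<Sum>x\<in>Pow I. if j \<in> S x then f x * edge_flow I q f j x else 0))"
      using once cut assms(1) sign by (intro sum.cong refl sum_edge_flow_charged) auto
    also have "\<dots> = 2 * (\<Sum>x\<in>Pow I. \<Sum>j\<in>I. if j \<in> S x then f x * edge_flow I q f j x else 0)"
      unfolding sum_distrib_left[symmetric] by (subst sum.swap) (rule refl)
    also have "\<dots> = 2 * (\<Sum>x\<in>Pow I. f x * (\<Sum>j\<in>S x. edge_flow I q f j x))"
    proof -
      have "(\<Sum>j\<in>I. if j \<in> S x then f x * edge_flow I q f j x else 0)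
          = f x * (\<Sum>j\<in>S x. edge_flow I q f j x)" if "x \<in> Pow I" for x
        using S[of x] that assms(1)
        by (simp add: sum.inter_restrict[symmetric] sum_distrib_left Int_absorb1)
      then show ?thesis by simp
    qed
    also have "\<dots> \<le> 2 * (\<Sum>x\<in>Pow I. Bernstein_variation (card (S x)) q)"
    proof (intro mult_left_mono sum_mono)
      fix x assume "x \<in> Pow I"
      have "f x * (\<Sum>j\<in>S x. edge_flow I q f j x) \<le> \<bar>\<Sum>j\<in>S x. edge_flow I q f j x\<bar>"
        using sign[of x] by auto
      also have "\<dots> \<le> Bernstein_variation (card (S x)) q"
      proof (rule abs_sum_edge_flow_le[OF assms(1)])
        show "\<bar>f y\<bar> \<le> 1" for y using sign[of y] by auto
      qed (use S[of x] \<open>x \<in> Pow I\<close> q in auto)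
      finally show "f x * (\<Sum>j\<in>S x. edge_flow I q f j x) \<le> Bernstein_variation (card (S x)) q" .
    qed simp
    finally show ?thesis .
  qed
  ultimately have "- noise_correlation I f (1/2) - - noise_correlation I f 0
      \<le> 2 * (\<Sum>x\<in>Pow I. Ramanujan_Q (card (S x)))"
    by (rule has_integral_le)
  moreover have "(\<Sum>x\<in>Pow I. (f x)\<^sup>2) = (\<Sum>x\<in>Pow I. 1)"
  proof (rule sum.cong[OF refl])
    show "(f x)\<^sup>2 = 1" for x using sign[of x] by auto
  qed
  ultimately show ?thesis
    using assms(1) by (simp add: noise_correlation_0 noise_correlation_half card_Pow)
qed

section \<open>The inequality for a partition of the cube\<close>

text \<open>The separator \<open>W\<close> is split into \<open>W1\<close> and \<open>W2\<close>: a vertex joins the side of \<open>A\<close> if more than half of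
its neighbours lie in \<open>A\<close>. The cut is then charged as follows: an edge between \<open>A\<close> and \<open>B\<close> to its
endpoint in \<open>B\<close>, an edge between \<open>A\<close> and \<open>W2\<close> to its endpoint in \<open>W2\<close>, and all the cut edges at \<open>W1\<close> to
their endpoint in \<open>W1\<close>. A vertex of \<open>W2\<close> receives at most half of its edges and a vertex of \<open>W1\<close>
fewer than half. The price of moving \<open>W1\<close> to the side of \<open>A\<close> is the square of the mean of \<open>f\<close>; it is
quadratic in the size of \<open>W1\<close>, and the saving of \<open>1 / sqrt n\<close> at each vertex of \<open>W1\<close> covers it.\<close>

theorem Pow_partition_isoperimetry:
  fixes A B W :: "'a set set"
  assumes "finite I" "I \<noteq> {}"
    and part: "A \<union> B \<union> W = Pow I" "A \<inter> B = {}" "A \<inter> W = {}" "B \<inter> W = {}"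
    and half: "2 * card A = 2 ^ card I"
  shows "2 ^ card I / 2
       \<le> (\<Sum>y\<in>B. real (card {j \<in> I. sym_diff y {j} \<in> A})) + sqrt (real (card I)) * real (card W)"
proof (rule ccontr)
  assume neg: "\<not> ?thesis"
  define s where "s = sqrt (real (card I))"
  define N where "N = (2 ^ card I :: real)"
  define nbrs where "nbrs y = {j \<in> I. sym_diff y {j} \<in> A}" for y
  define W1 where "W1 = {y \<in> W. card I < 2 * card (nbrs y)}"
  define W2 where "W2 = W - W1"
  define f where "f x = (if x \<in> A \<union> W1 then 1 else - 1 :: real)" for x
  define S where "S x = (if x \<in> A then {} else if x \<in> W1 then {j \<in> I. sym_diff x {j} \<notin> A \<union> W1} else nbrs x)" for x
  have "finite (A \<union> B \<union> W)" using assms(1) part(1) by simp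
  then have fin: "finite A" "finite B" "finite W1" "finite W2" "finite W"
    by (auto simp: W1_def W2_def)
  have s: "s > 0" using assms(1,2) by (simp add: s_def card_gt_0_iff)
  have N: "N > 0" by (simp add: N_def)
  have invol: "sym_diff (sym_diff x {j}) {j} = x" for x :: "'a set" and j by auto
  have W: "W = W1 \<union> W2" "W1 \<inter> W2 = {}" by (auto simp: W1_def W2_def)
  have cells: "Pow I = A \<union> (B \<union> (W1 \<union> W2))" using part(1) W(1) by blast

  have "2 ^ card I - (\<Sum>x\<in>Pow I. f x)\<^sup>2 / 2 ^ card I
      \<le> 2 * (\<Sum>x\<in>Pow I. Ramanujan_Q (card (S x)))"
  proof (rule variance_le_sum_Ramanujan_Q[OF assms(1)])
    show "f x = 1 \<or> f x = - 1" for x by (simp add: f_def)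
    show "S x \<subseteq> I" for x by (auto simp: S_def nbrs_def)
    show "j \<in> S x \<longleftrightarrow> j \<notin> S (sym_diff x {j})" if "j \<in> I" "f x \<noteq> f (sym_diff x {j})" for x j
    proof -
      have disj: "y \<notin> A" if "y \<in> W1" for y using that part(3) by (auto simp: W1_def)
      have S_iff: "j \<in> S y \<longleftrightarrow> y \<notin> A \<and> (if y \<in> W1 then sym_diff y {j} \<notin> A \<union> W1 else sym_diff y {j} \<in> A)" for y
        using \<open>j \<in> I\<close> by (auto simp: S_def nbrs_def)
      show ?thesis
        using that(2) disj unfolding S_iff invol f_def by (auto split: if_splits)
    qed
    show "f x \<noteq> f (sym_diff x {j})" if "j \<in> S x" for x j
      using that unfolding S_def f_def nbrs_def by (auto split: if_splits)
  qed
  moreover have "(\<Sum>x\<in>Pow I. f x) = 2 * real (card W1)"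
  proof -
    have "(\<Sum>x\<in>Pow I. f x) = (\<Sum>x\<in>Pow I. 2 * indicator (A \<union> W1) x - 1)"
      by (intro sum.cong) (auto simp: f_def)
    also have "\<dots> = 2 * (\<Sum>x\<in>Pow I. indicator (A \<union> W1) x) - N"
      using assms(1) by (simp add: sum_subtractf sum_distrib_left card_Pow N_def)
    also have "(\<Sum>x\<in>Pow I. indicator (A \<union> W1) x) = real (card (Pow I \<inter> (A \<union> W1)))"
      unfolding indicator_def using assms(1) by (subst sum_of_bool_eq) (simp_all only: finite_Pow_iff Collect_mem_eq)
    also have "Pow I \<inter> (A \<union> W1) = A \<union> W1" using cells by blast
    also have "card (A \<union> W1) = card A + card W1"
      using fin part(3) by (intro card_Un_disjoint) (auto simp: W1_def)
    finally show ?thesis using arg_cong[OF half, of real] by (simp add: N_def)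
  qed
  moreover have "(\<Sum>x\<in>Pow I. Ramanujan_Q (card (S x)))
      \<le> (\<Sum>y\<in>B. real (card (nbrs y))) + s * real (card W) - real (card W1) / s"
  proof -
    have "(\<Sum>x\<in>Pow I. Ramanujan_Q (card (S x)))
        = (\<Sum>x\<in>A. Ramanujan_Q (card (S x))) + ((\<Sum>x\<in>B. Ramanujan_Q (card (S x)))
          + ((\<Sum>x\<in>W1. Ramanujan_Q (card (S x))) + (\<Sum>x\<in>W2. Ramanujan_Q (card (S x)))))"
      unfolding cells using fin part W
      by (subst sum.union_disjoint; (subst sum.union_disjoint)?; (subst sum.union_disjoint)?) auto
    moreover have "(\<Sum>x\<in>A. Ramanujan_Q (card (S x))) = 0"
      by (intro sum.neutral) (simp add: S_def Ramanujan_Q_def)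
    moreover have "(\<Sum>x\<in>B. Ramanujan_Q (card (S x))) \<le> (\<Sum>y\<in>B. real (card (nbrs y)))"
    proof (rule sum_mono)
      fix y assume "y \<in> B"
      then have "S y = nbrs y" using part by (auto simp: S_def W1_def)
      then show "Ramanujan_Q (card (S y)) \<le> real (card (nbrs y))" by (simp add: Ramanujan_Q_le)
    qed
    moreover have "(\<Sum>x\<in>W1. Ramanujan_Q (card (S x))) \<le> (\<Sum>x\<in>W1. s - 1 / s)"
    proof (rule sum_mono)
      fix x assume x: "x \<in> W1"
      then have "S x = {j \<in> I. sym_diff x {j} \<notin> A \<union> W1}"
        using part(3) by (auto simp: S_def W1_def)
      then have "card (S x) + card (nbrs x) = card (S x \<union> nbrs x)"
        using assms(1) by (intro card_Un_disjoint[symmetric]) (auto simp: nbrs_def)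
      also have "\<dots> \<le> card I"
        using assms(1) by (intro card_mono) (auto simp: S_def nbrs_def)
      finally have "2 * real (card (S x)) + 1 \<le> real (card I)"
        using x by (simp add: W1_def)
      then show "Ramanujan_Q (card (S x)) \<le> s - 1 / s"
        unfolding s_def by (rule Ramanujan_Q_le_sqrt_minus)
    qed
    moreover have "(\<Sum>x\<in>W2. Ramanujan_Q (card (S x))) \<le> (\<Sum>x\<in>W2. s)"
    proof (rule sum_mono)
      fix x assume x: "x \<in> W2"
      then have "S x = nbrs x" using part(3) by (auto simp: S_def W2_def)
      moreover have "2 * card (nbrs x) \<le> card I"
        using x by (auto simp: W1_def W2_def)
      ultimately have "2 * real (card (S x)) \<le> real (card I)" by simp
      then show "Ramanujan_Q (card (S x)) \<le> s"
        unfolding s_def by (rule Ramanujan_Q_le_sqrt)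
    qed
    moreover have "card W = card W1 + card W2"
      unfolding W(1) using fin W by (intro card_Un_disjoint) auto
    ultimately show ?thesis by (simp add: algebra_simps)
  qed
  ultimately have main: "N / 2 - 2 * (real (card W1))\<^sup>2 / N
      \<le> (\<Sum>y\<in>B. real (card (nbrs y))) + s * real (card W) - real (card W1) / s"
    unfolding N_def[symmetric] by (simp add: power_mult_distrib)
  have neg': "(\<Sum>y\<in>B. real (card (nbrs y))) + s * real (card W) < N / 2"
    using neg by (simp add: nbrs_def s_def N_def)
  \<comment> \<open>The failure of the claim bounds \<open>W\<close>, and this makes the quadratic price at most the saving.\<close>
  have "s * real (card W1) \<le> s * real (card W)"
    using s fin W(1) by (intro mult_left_mono) (auto intro: card_mono)
  moreover have "0 \<le> (\<Sum>y\<in>B. real (card (nbrs y)))" by (intro sum_nonneg) auto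
  ultimately have "2 * (s * real (card W1)) \<le> N" using neg' by linarith
  then have "2 * (s * real (card W1)) * real (card W1) \<le> N * real (card W1)"
    by (rule mult_right_mono) simp
  then have "2 * (real (card W1))\<^sup>2 / N \<le> real (card W1) / s"
    using s N by (simp add: field_simps power2_eq_square)
  with main neg' show False by linarith
qed

section \<open>Bit strings as subsets\<close>

definition support :: "bool list \<Rightarrow> nat set" where
  "support x = {i. i < length x \<and> x ! i}"

lemma bij_betw_support: "bij_betw support (cube n) (Pow {..<n})"
proof (rule bij_betw_byWitness[where f' = "\<lambda>s. map (\<lambda>i. i \<in> s) [0..<n]"])
  show "\<forall>x\<in>cube n. map (\<lambda>i. i \<in> support x) [0..<n] = x"
    by (auto simp: cube_def support_def intro: nth_equalityI)
qed (auto simp: cube_def support_def)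

lemma support_flip:
  "j < length y \<Longrightarrow> support (y[j := \<not> y ! j]) = sym_diff (support y) {j}"
  by (auto simp: support_def nth_list_update split: if_splits)

lemma hamming_edges_iff_flip:
  assumes "y \<in> cube n"
  shows "(x, y) \<in> hamming_edges n \<longleftrightarrow> (\<exists>j<n. x = y[j := \<not> y ! j])"
proof
  assume "(x, y) \<in> hamming_edges n"
  then have len: "length x = n" "length y = n" and "card {i. i < n \<and> x ! i \<noteq> y ! i} = 1"
    by (auto simp: hamming_edges_def cube_def)
  then obtain j where j: "{i. i < n \<and> x ! i \<noteq> y ! i} = {j}"
    by (elim card_1_singletonE)
  have "j < n" using j by blast
  have differ: "x ! i \<noteq> y ! i \<longleftrightarrow> i = j" if "i < n" for i using j that by blast
  have "x = y[j := \<not> y ! j]"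
  proof (rule nth_equalityI)
    fix i assume "i < length x"
    then show "x ! i = y[j := \<not> y ! j] ! i"
      using differ[of i] len by (cases "i = j") auto
  qed (simp add: len)
  then show "\<exists>j<n. x = y[j := \<not> y ! j]" using \<open>j < n\<close> by blast
next
  assume "\<exists>j<n. x = y[j := \<not> y ! j]"
  then obtain j where j: "j < n" "x = y[j := \<not> y ! j]" by blast
  then have "{i. i < n \<and> x ! i \<noteq> y ! i} = {j}"
    using assms by (auto simp: cube_def nth_list_update)
  then show "(x, y) \<in> hamming_edges n"
    using j assms by (auto simp: hamming_edges_def cube_def)
qed

lemma finite_cube: "finite (cube n)"
  using bij_betw_finite[OF bij_betw_support] by simp

text \<open>The edges between \<open>A\<close> and \<open>B\<close> are listed by their endpoint in \<open>B\<close> and the coordinate that is flipped.\<close>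

lemma card_edges_eq_sum_flips:
  assumes "A \<subseteq> cube n" "B \<subseteq> cube n"
  shows "card {(x, y) \<in> hamming_edges n. x \<in> A \<and> y \<in> B}
       = (\<Sum>s\<in>support ` B. card {j \<in> {..<n}. sym_diff s {j} \<in> support ` A})"
proof -
  have inj: "inj_on support (cube n)" using bij_betw_support by (rule bij_betw_imp_inj_on)
  have finB: "finite B" using assms(2) finite_cube by (rule finite_subset)
  let ?flip = "\<lambda>y j. y[j := \<not> y ! j]"
  let ?J = "\<lambda>y. {j \<in> {..<n}. ?flip y j \<in> A}"
  have "bij_betw (\<lambda>(y, j). (?flip y j, y)) (SIGMA y:B. ?J y) {(x, y) \<in> hamming_edges n. x \<in> A \<and> y \<in> B}"
  proof (rule bij_betw_imageI)
    show "inj_on (\<lambda>(y, j). (?flip y j, y)) (SIGMA y:B. ?J y)"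
    proof (rule inj_onI, clarsimp)
      fix y i j assume "y \<in> B" "i < n" "j < n" and eq: "?flip y i = ?flip y j"
      with assms(2) have "i < length y" "j < length y" by (auto simp: cube_def)
      then have "sym_diff (support y) {i} = sym_diff (support y) {j}"
        using eq support_flip by metis
      then show "i = j" by blast
    qed
    show "(\<lambda>(y, j). (?flip y j, y)) ` (SIGMA y:B. ?J y) = {(x, y) \<in> hamming_edges n. x \<in> A \<and> y \<in> B}"
      using assms(2) hamming_edges_iff_flip by (fastforce simp: image_iff)
  qed
  then have "card {(x, y) \<in> hamming_edges n. x \<in> A \<and> y \<in> B} = card (SIGMA y:B. ?J y)"
    by (rule bij_betw_same_card[symmetric])
  also have "\<dots> = (\<Sum>y\<in>B. card (?J y))"
    using finB by (intro card_SigmaI) auto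
  also have "\<dots> = (\<Sum>y\<in>B. card {j \<in> {..<n}. sym_diff (support y) {j} \<in> support ` A})"
  proof (rule sum.cong[OF refl])
    fix y assume "y \<in> B"
    then have len: "length y = n" using assms(2) by (auto simp: cube_def)
    have "?flip y j \<in> A \<longleftrightarrow> sym_diff (support y) {j} \<in> support ` A" if "j < n" for j
    proof -
      have "?flip y j \<in> cube n" using len by (simp add: cube_def)
      then have "support (?flip y j) \<in> support ` A \<longleftrightarrow> ?flip y j \<in> A"
        by (rule inj_on_image_mem_iff[OF inj _ assms(1)])
      then show ?thesis using support_flip[of j y] that len by simp
    qed
    then have "?J y = {j \<in> {..<n}. sym_diff (support y) {j} \<in> support ` A}" by blast
    then show "card (?J y) = card {j \<in> {..<n}. sym_diff (support y) {j} \<in> support ` A}" by simp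
  qed
  also have "\<dots> = (\<Sum>s\<in>support ` B. card {j \<in> {..<n}. sym_diff s {j} \<in> support ` A})"
    using inj_on_subset[OF inj assms(2)] by (simp add: sum.reindex)
  finally show ?thesis .
qed

lemma cube_measure_eq_card:
  assumes "S \<subseteq> cube n"
  shows "cube_measure n S = real (card (support ` S)) / 2 ^ n"
proof -
  have "inj_on support S"
    using assms bij_betw_imp_inj_on[OF bij_betw_support] by (rule inj_on_subset[rotated])
  then have "card (support ` S) = card S" by (rule card_image)
  moreover have "cube n \<inter> S = S" using assms by blast
  ultimately show ?thesis
    unfolding cube_measure_def by (simp add: indicator_def sum_of_bool_eq finite_cube)
qed

theorem theorem1p2:
  fixes n :: nat and A B W :: "bool list set"
  assumes "n \<ge> 1"
    and "is_cube_partition n A B W"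
    and "cube_measure n A = 1 / 2"
  shows "edge_boundary_measure n A B + sqrt (real n) * cube_measure n W \<ge> 1 / 2"
proof -
  from assms(2) have part: "A \<union> B \<union> W = cube n" "A \<inter> B = {}" "A \<inter> W = {}" "B \<inter> W = {}"
    and sub: "A \<subseteq> cube n" "B \<subseteq> cube n" "W \<subseteq> cube n"
    by (auto simp: is_cube_partition_def)
  have inj: "inj_on support (cube n)" using bij_betw_support by (rule bij_betw_imp_inj_on)
  have disj: "support ` X \<inter> support ` Y = {}" if "X \<inter> Y = {}" "X \<subseteq> cube n" "Y \<subseteq> cube n" for X Y
    using inj_on_image_Int[OF inj that(2,3)] that(1) by simp
  have "2 ^ card {..<n} / 2
      \<le> (\<Sum>s\<in>support ` B. real (card {j \<in> {..<n}. sym_diff s {j} \<in> support ` A}))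
        + sqrt (real (card {..<n})) * real (card (support ` W))"
  proof (rule Pow_partition_isoperimetry)
    have "0 \<in> {..<n}" using assms(1) by simp
    then show "{..<n} \<noteq> {}" by blast
    show "support ` A \<union> support ` B \<union> support ` W = Pow {..<n}"
      using bij_betw_imp_surj_on[OF bij_betw_support] part(1) by (metis image_Un)
    have "real (2 * card (support ` A)) = real (2 ^ n)"
      using assms(3) cube_measure_eq_card[OF sub(1)] by simp
    then show "2 * card (support ` A) = 2 ^ card {..<n}"
      unfolding of_nat_eq_iff by simp
  qed (use disj part sub in auto)
  then have "(1 / 2 :: real) \<le> real (card {(x, y) \<in> hamming_edges n. x \<in> A \<and> y \<in> B}) / 2 ^ n
      + sqrt (real n) * (real (card (support ` W)) / 2 ^ n)"
    unfolding card_edges_eq_sum_flips[OF sub(1,2)]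
    by (simp add: field_simps)
  then show ?thesis
    unfolding edge_boundary_measure_def cube_measure_eq_card[OF sub(3)] .
qed

end
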